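(* (1) Let $k_1,m_1,k_2,m_2\in\mathbb{N}$ and $\alpha\in\mathbb{Q}$ with $0^{k_1}1^{m_1}0^{k_2}1^{m_2}(\alpha)=1$. Then $$\alpha=\left[\frac{2}{3}\right]^{m_{2}}\left(2^{k_{2}}\left(\left[\frac{2}{3}\right]^{m_{1}}\left(2^{k_{1}}+1\right)-1\right)+1\right)-1.$$ (2) Furthermore, for all $l_1,l_2,m_1,m_2\in\mathbb{N}$, if $$k_2=2l_2\cdot 3^{m_2-1}\quad\text{and}\quad k_1=(2l_1-1)\cdot 3^{m_1+m_2-1},$$ then the number $\alpha$ given by the formula in (1) is a solution in $\mathbb{N}$, i.e. $\alpha\in\mathbb{N}$ and $0^{k_1}1^{m_1}0^{k_2}1^{m_2}(\alpha)=1$.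
   Context: $\mathbb{N}=\{1,2,3,\ldots\}$. The symbols $0$ and $1$, when used as letters in a word applied to a number, denote the maps $0:x\mapsto \frac{x}{2}$ and $1:x\mapsto\frac{3x+1}{2}$, here regarded as maps $\mathbb{Q}\to\mathbb{Q}$. Words denote compositions read from right to left (the rightmost letter is applied first), and $s^k$ denotes the $k$-fold composition of $s$ with itself; thus $0^{k_1}1^{m_1}0^{k_2}1^{m_2}(\alpha)$ means: apply $1$ exactly $m_2$ times to $\alpha$, then $0$ exactly $k_2$ times, then $1$ exactly $m_1$ times, then $0$ exactly $k_1$ times. Square brackets are ordinary parentheses. *)

theory Defs
  imports Complex_Main
begin

definition letter0 :: "rat \<Rightarrow> rat" where
  "letter0 x = x / 2"

text \<open>The accelerated odd Collatz step. Both letters are total maps on the rationals; no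
  parity condition restricts their application.\<close>
definition letter1 :: "rat \<Rightarrow> rat" where
  "letter1 x = (3 * x + 1) / 2"

end

theory Submission
  imports Defs
begin

text \<open>The letter \<open>1\<close> is the affine map with fixed point \<open>-1\<close> and slope \<open>3/2\<close>, so its powers have
  a closed form and the equation can be solved for \<open>\<alpha>\<close>. Integrality of the solution rests on
  \<open>2 ^ 3 ^ n \<equiv> -1 (mod 3 ^ (n + 1))\<close>: an odd multiple of \<open>3 ^ n\<close> in the exponent of \<open>2\<close> gives \<open>-1\<close>
  and an even multiple gives \<open>1\<close>.\<close>

lemma letter0_funpow: "(letter0 ^^ k) x = x / 2 ^ k"
  by (induction k) (simp_all add: letter0_def)

lemma letter1_funpow: "(letter1 ^^ m) x = (3 / 2) ^ m * (x + 1) - 1"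
  by (induction m) (simp_all add: letter1_def field_simps)

text \<open>Every power of a letter is a bijection of the rationals, so the word can be inverted
  block by block, outermost block first. The equivalence gives uniqueness in part (1) and the word
  equation in part (2).\<close>

lemma word_eq_1_iff:
  "((letter0 ^^ k1) \<circ> (letter1 ^^ m1) \<circ> (letter0 ^^ k2) \<circ> (letter1 ^^ m2)) \<alpha> = 1 \<longleftrightarrow>
    \<alpha> = (2 / 3) ^ m2 * (2 ^ k2 * ((2 / 3) ^ m1 * (2 ^ k1 + 1) - 1) + 1) - 1"
proof -
  have letter0_iff: "(letter0 ^^ k) x = y \<longleftrightarrow> x = 2 ^ k * y" for k x y
    by (auto simp: letter0_funpow field_simps)
  have letter1_iff: "(letter1 ^^ m) x = y \<longleftrightarrow> x = (2 / 3) ^ m * (y + 1) - 1" for m x y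
    by (auto simp: letter1_funpow field_simps)
  show ?thesis
    by (simp add: letter0_iff letter1_iff)
qed

text \<open>Passing from \<open>n\<close> to \<open>Suc n\<close> cubes
  \<open>x = 2 ^ 3 ^ n\<close>, and \<open>x ^ 3 + 1\<close> factors as \<open>x + 1\<close> times
  \<open>(x + 1)\<^sup>2 - 3 * x\<close>. Since 3 divides \<open>x + 1\<close>, the second factor
  contributes one more 3.\<close>

lemma three_power_dvd_two_power_add_1: "(3::int) ^ Suc n dvd 2 ^ 3 ^ n + 1"
proof (induction n)
  case 0
  show ?case by simp
next
  case (Suc n)
  define x :: int where "x = 2 ^ 3 ^ n"
  have IH: "3 * 3 ^ n dvd x + 1"
    using Suc by (simp add: x_def)
  then have "3 dvd x + 1"
    by (rule dvd_mult_left)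
  then have "3 dvd (x + 1) * (x + 1) - 3 * x"
    by (intro dvd_diff dvd_mult dvd_triv_left)
  then have "(3 * 3 ^ n) * 3 dvd (x + 1) * ((x + 1) * (x + 1) - 3 * x)"
    by (rule mult_dvd_mono[OF IH])
  also have "(x + 1) * ((x + 1) * (x + 1) - 3 * x) = x ^ 3 + 1"
    by (simp add: algebra_simps power3_eq_cube)
  also have "x ^ 3 = 2 ^ 3 ^ Suc n"
    by (simp add: x_def mult.commute flip: power_mult)
  finally show ?case
    by (simp add: ac_simps)
qed

lemma minus_1_dvd_power_minus_1: "x - 1 dvd x ^ l - (1::'a::comm_ring_1)"
  by (metis dvd_triv_left power_diff_1_eq)

lemma add_1_dvd_square_minus_1: "x + 1 dvd x\<^sup>2 - (1::'a::comm_ring_1)"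
  by (simp add: dvd_def power2_eq_square) (metis square_diff_one_factored)

lemma add_1_dvd_even_power_minus_1: "x + 1 dvd x ^ (2 * l) - (1::'a::comm_ring_1)"
  unfolding power_mult
  by (rule dvd_trans[OF add_1_dvd_square_minus_1 minus_1_dvd_power_minus_1])

text \<open>Reduces to the even case by splitting off one factor \<open>x\<close>: the sum equals
  \<open>x * (x ^ (2 * l) - 1) + (x + 1)\<close>.\<close>

lemma add_1_dvd_odd_power_add_1: "x + 1 dvd x ^ (2 * l + 1) + (1::'a::comm_ring_1)"
proof -
  have "x + 1 dvd x * (x ^ (2 * l) - 1) + (x + 1)"
    by (intro dvd_add dvd_mult add_1_dvd_even_power_minus_1 dvd_refl)
  then show ?thesis
    by (simp add: algebra_simps)
qed

lemma three_power_dvd_two_power_even_mult: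
  "(3::int) ^ Suc n dvd 2 ^ (2 * l * 3 ^ n) - 1"
  using dvd_trans[OF three_power_dvd_two_power_add_1 add_1_dvd_even_power_minus_1[of "2 ^ 3 ^ n" l]]
  by (simp add: mult.commute flip: power_mult)

lemma three_power_dvd_two_power_odd_mult:
  "(3::int) ^ Suc n dvd 2 ^ ((2 * l + 1) * 3 ^ n) + 1"
  using dvd_trans[OF three_power_dvd_two_power_add_1 add_1_dvd_odd_power_add_1[of "2 ^ 3 ^ n" l]]
  by (simp only: mult.commute flip: power_mult)

text \<open>Of the factors 3 provided by \<open>dvd1\<close>, \<open>m1\<close> clear the inner
  denominator. The other \<open>m2\<close>, together with \<open>dvd2\<close>, make the outer
  bracket a multiple of \<open>3 ^ m2\<close>, which clears the outer denominator.\<close>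

lemma solution_is_nat:
  fixes \<alpha> :: rat
  assumes dvd1: "(3::int) ^ (m1 + m2) dvd 2 ^ k1 + 1"
    and dvd2: "(3::int) ^ m2 dvd 2 ^ k2 - 1"
    and "1 \<le> m2"
    and \<alpha>: "\<alpha> = (2 / 3) ^ m2 * (2 ^ k2 * ((2 / 3) ^ m1 * (2 ^ k1 + 1) - 1) + 1) - 1"
  shows "\<exists>n::nat. 1 \<le> n \<and> \<alpha> = of_nat n"
proof -
  obtain a where a: "2 ^ k1 + 1 = (3::int) ^ (m1 + m2) * a"
    using dvd1 by (elim dvdE)
  obtain d where d: "2 ^ k2 - 1 = (3::int) ^ m2 * d"
    using dvd2 by (elim dvdE)
  \<comment> \<open>Chosen so that the outer bracket, rewritten as
    \<open>2 ^ k2 * (2 ^ m1 * 3 ^ m2 * a) - (2 ^ k2 - 1)\<close>, equals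
    \<open>3 ^ m2 * c\<close>.\<close>
  define c where "c = 2 ^ k2 * (2 ^ m1 * a) - d"
  have "0 < (3::int) ^ (m1 + m2) * a"
    unfolding a[symmetric] by (simp add: add_pos_pos)
  then have "0 < a"
    by (simp add: zero_less_mult_iff)
  then have "1 \<le> 2 ^ m1 * (3 ^ m2 * a)"
    by (simp add: int_one_le_iff_zero_less)
  then have "0 \<le> 2 ^ k2 * (2 ^ m1 * (3 ^ m2 * a) - 1)"
    by simp
  also have "\<dots> = 3 ^ m2 * c - 1"
    using d by (simp add: c_def algebra_simps)
  finally have "0 < 3 ^ m2 * c"
    by simp
  then have "1 \<le> c"
    by (simp add: zero_less_mult_iff)
  \<comment> \<open>With only \<open>1 \<le> c\<close>, a factor of at least 2 is what makes
    \<open>2 ^ m2 * c - 1\<close> positive rather than merely nonnegative.\<close>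
  moreover have "2 \<le> (2::int) ^ m2"
    using power_increasing[OF \<open>1 \<le> m2\<close>, of "2::int"] by simp
  ultimately have "2 * 1 \<le> 2 ^ m2 * c"
    by (intro mult_mono) simp_all
  moreover have "\<alpha> = of_int (2 ^ m2 * c - 1)"
  proof -
    have a': "2 ^ k1 + 1 = (3::rat) ^ (m1 + m2) * of_int a"
      using arg_cong[OF a, of "of_int :: int \<Rightarrow> rat"] by simp
    have d': "2 ^ k2 = (3::rat) ^ m2 * of_int d + 1"
      using arg_cong[OF d, of "of_int :: int \<Rightarrow> rat"] by (simp add: algebra_simps)
    have "2 ^ k2 * ((2 / 3) ^ m1 * (2 ^ k1 + 1) - 1) + 1
        = 2 ^ k2 * (2 ^ m1 * 3 ^ m2 * of_int a) - ((2::rat) ^ k2 - 1)"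
      unfolding a' by (simp add: power_divide power_add algebra_simps)
    also have "\<dots> = 3 ^ m2 * of_int c"
      by (simp add: c_def d' algebra_simps)
    finally show ?thesis
      unfolding \<alpha> by (simp add: power_divide)
  qed
  ultimately show ?thesis
    by (intro exI[of _ "nat (2 ^ m2 * c - 1)"]) (simp add: le_nat_iff)
qed

theorem theorem4p1:
  "(\<forall>(k1::nat) (m1::nat) (k2::nat) (m2::nat) (\<alpha>::rat).
      1 \<le> k1 \<longrightarrow> 1 \<le> m1 \<longrightarrow> 1 \<le> k2 \<longrightarrow> 1 \<le> m2 \<longrightarrow>
      ((letter0 ^^ k1) \<circ> (letter1 ^^ m1) \<circ> (letter0 ^^ k2) \<circ> (letter1 ^^ m2)) \<alpha> = 1 \<longrightarrow>
      \<alpha> = (2 / 3) ^ m2 * (2 ^ k2 * ((2 / 3) ^ m1 * (2 ^ k1 + 1) - 1) + 1) - 1)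
   \<and>
   (\<forall>(l1::nat) (l2::nat) (m1::nat) (m2::nat) (k1::nat) (k2::nat) (\<alpha>::rat).
      1 \<le> l1 \<longrightarrow> 1 \<le> l2 \<longrightarrow> 1 \<le> m1 \<longrightarrow> 1 \<le> m2 \<longrightarrow>
      k2 = 2 * l2 * 3 ^ (m2 - 1) \<longrightarrow>
      k1 = (2 * l1 - 1) * 3 ^ (m1 + m2 - 1) \<longrightarrow>
      \<alpha> = (2 / 3) ^ m2 * (2 ^ k2 * ((2 / 3) ^ m1 * (2 ^ k1 + 1) - 1) + 1) - 1 \<longrightarrow>
      (\<exists>n::nat. 1 \<le> n \<and> \<alpha> = of_nat n) \<and>
      ((letter0 ^^ k1) \<circ> (letter1 ^^ m1) \<circ> (letter0 ^^ k2) \<circ> (letter1 ^^ m2)) \<alpha> = 1)"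
proof (intro conjI allI impI)
  fix l1 l2 m1 m2 k1 k2 :: nat and \<alpha> :: rat
  assume "1 \<le> l1" and "1 \<le> m2"
    and k2: "k2 = 2 * l2 * 3 ^ (m2 - 1)"
    and k1: "k1 = (2 * l1 - 1) * 3 ^ (m1 + m2 - 1)"
    and \<alpha>: "\<alpha> = (2 / 3) ^ m2 * (2 ^ k2 * ((2 / 3) ^ m1 * (2 ^ k1 + 1) - 1) + 1) - 1"
  \<comment> \<open>Subtraction on naturals truncates, so both identities rely on the lower bounds
    for \<open>l1\<close> and \<open>m2\<close>.\<close>
  have "2 * l1 - 1 = 2 * (l1 - 1) + 1" and "Suc (m1 + m2 - 1) = m1 + m2"
    using \<open>1 \<le> l1\<close> \<open>1 \<le> m2\<close> by simp_all
  then have "(3::int) ^ (m1 + m2) dvd 2 ^ k1 + 1"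
    using three_power_dvd_two_power_odd_mult[of "m1 + m2 - 1" "l1 - 1"]
    unfolding k1 by (simp only:)
  moreover have "(3::int) ^ m2 dvd 2 ^ k2 - 1"
    using three_power_dvd_two_power_even_mult[of "m2 - 1" l2] \<open>1 \<le> m2\<close>
    unfolding k2 by simp
  ultimately show "\<exists>n::nat. 1 \<le> n \<and> \<alpha> = of_nat n"
    using \<open>1 \<le> m2\<close> \<alpha> by (rule solution_is_nat)
\<comment> \<open>The goals left are part (1) and the word equation of part (2), one for each
  direction of the equivalence.\<close>
qed (simp_all only: word_eq_1_iff)

end
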